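(* Let $d,T$ be integers with $1\le d\le T/2$. There are a domain $\mathcal X$ and a class $\mathcal H$ of functions $\mathcal X\to[0,1]$ with $|\mathcal H|=2^d$ such that for every grid size $N$ and every randomized online learner predicting on $\Gamma_N$ there is a deterministic sequence $(x_t,y_t)_{t=1}^T$ with $$\mathbb E\,\mathrm{SwapReg}_T(\ell_\vee,\mathcal H)\ \ge\ \frac1{48}\sqrt{dT}\ =\ \Omega\!\left(\sqrt{T\log|\mathcal H|}\right),$$ where $$\ell_\vee(p,y)=\begin{cases}y-\frac12,&p\le\frac12,\\[2pt]\frac12-y,&p>\frac12,\end{cases}$$ and the expectation is over the learner's randomness.
   Context: $\Gamma_N=\{0,1/N,\dots,1\}$. At round $t=1,\dots,T$ the learner sees $x_t\in\mathcal X$, announces a distribution $\psi_t$ on $\Gamma_N$ (a function of the past transcript $(x_s,p_s,y_s)_{s<t}$ and of $x_t$), draws $p_t\sim\psi_t$, and then sees $y_t\in\{0,1\}$. Swap regret: $$\mathrm{SwapReg}_T(\ell,\mathcal H)=\sup_{\phi:\Gamma_N\to\mathcal H}\sum_{t=1}^T\big[\ell(p_t,y_t)-\ell(\phi(p_t)(x_t),y_t)\big].$$ *)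

theory Defs
  imports "HOL-Probability.Probability"
begin

definition grid :: "nat \<Rightarrow> real set" where
  "grid N = {real k / real N | k. k \<le> N}"

type_synonym 'x transcript = "('x \<times> real \<times> real) list"

text \<open>Transcripts list the triples (context, prediction, outcome) with the earliest round first.
  A learner maps the past transcript and the current context to the distribution of its
  prediction; only its values on transcripts that can actually arise are constrained.\<close>

type_synonym 'x learner = "'x transcript \<Rightarrow> 'x \<Rightarrow> real pmf"

definition predicts_on_grid :: "'x set \<Rightarrow> nat \<Rightarrow> 'x learner \<Rightarrow> bool" where
  "predicts_on_grid X N L \<longleftrightarrow>
     (\<forall>h x. set h \<subseteq> X \<times> grid N \<times> {0, 1} \<longrightarrow> x \<in> X \<longrightarrow> set_pmf (L h x) \<subseteq> grid N)"

text \<open>The law of the transcript after a given number of rounds, when the learner is run on the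
  fixed sequence \<open>(x t, y t)\<close>, with rounds numbered from 1.\<close>

primrec transcript_pmf ::
    "'x learner \<Rightarrow> (nat \<Rightarrow> 'x) \<Rightarrow> (nat \<Rightarrow> real) \<Rightarrow> nat \<Rightarrow> 'x transcript pmf" where
  "transcript_pmf L x y 0 = return_pmf []"
| "transcript_pmf L x y (Suc t) =
     bind_pmf (transcript_pmf L x y t)
       (\<lambda>h. map_pmf (\<lambda>p. h @ [(x (Suc t), p, y (Suc t))]) (L h (x (Suc t))))"

definition swap_regret ::
    "(real \<Rightarrow> real \<Rightarrow> real) \<Rightarrow> ('x \<Rightarrow> real) set \<Rightarrow> nat \<Rightarrow> 'x transcript \<Rightarrow> real" where
  "swap_regret loss H N tr =
     (SUP \<phi> \<in> grid N \<rightarrow>\<^sub>E H. \<Sum>(x, p, y) \<leftarrow> tr. loss p y - loss (\<phi> p x) y)"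

definition vee_loss :: "real \<Rightarrow> real \<Rightarrow> real" where
  "vee_loss p y = (if p \<le> 1/2 then y - 1/2 else 1/2 - y)"

end

theory Submission
  imports Defs
begin

text \<open>
  Let the contexts cycle through \<open>d\<close> points, take \<open>H\<close> to be all Boolean functions on them, and
  average over all Boolean outcome sequences. Since \<open>vee_loss p y = \<plusminus>(y - 1/2)\<close> with a sign fixed
  before \<open>y\<close> is revealed, the learner's average loss is \<open>0\<close>. A comparator that ignores the
  prediction can choose the better sign on each context, so its loss is minus the sum over the
  contexts of \<open>\<bar>\<Sum>(y\<^sub>t - 1/2)\<bar>\<close>; a fourth-moment form of Khintchine's inequality makes each of these
  terms at least of order \<open>sqrt (T / d)\<close> on average. Some outcome sequence is at least as bad as the
  average one.
\<close>

section \<open>Averages over the Boolean cube\<close>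

abbreviation cube :: "'i set \<Rightarrow> ('i \<Rightarrow> real) set" where
  "cube I \<equiv> I \<rightarrow>\<^sub>E {0, 1}"

lemma finite_cube: "finite I \<Longrightarrow> finite (cube I)"
  by (intro finite_PiE) auto

lemma card_cube: "finite I \<Longrightarrow> card (cube I) = 2 ^ card I"
  by (simp add: card_PiE numeral_2_eq_2)

text \<open>Flipping coordinate \<open>i\<close> is an involution of the cube, so the sum equals its
  own negative. It kills both the odd cross terms in the moments and each round's contribution to
  the learner's loss.\<close>

lemma sum_cube_odd_eq_0:
  fixes f :: "('i \<Rightarrow> real) \<Rightarrow> real"
  assumes i: "i \<in> I" and odd: "\<And>y. y \<in> cube I \<Longrightarrow> f (y(i := 1 - y i)) = - f y"
  shows "(\<Sum>y\<in>cube I. f y) = 0"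
proof -
  have flip: "y(i := 1 - y i) \<in> cube I" if "y \<in> cube I" for y
    using that i by (auto simp: PiE_iff extensional_def)
  have "(\<Sum>y\<in>cube I. f y) = (\<Sum>y\<in>cube I. f (y(i := 1 - y i)))"
    by (rule sum.reindex_bij_witness[where i = "\<lambda>y. y(i := 1 - y i)" and j = "\<lambda>y. y(i := 1 - y i)"])
      (use flip in auto)
  also have "\<dots> = - (\<Sum>y\<in>cube I. f y)"
    by (simp add: odd sum_negf)
  finally show ?thesis by simp
qed

section \<open>Khintchine's inequality for sums of independent signs\<close>

definition sign_sum :: "'i set \<Rightarrow> ('i \<Rightarrow> real) \<Rightarrow> real" where
  "sign_sum B y = (\<Sum>t\<in>B. 2 * y t - 1)"

text \<open>In probabilistic terms, E S^2 = n and E S^4 <= 3 n^2 for a sum S of n independent signs.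
  Adding a sign e with e^2 = 1, the terms odd in e average to 0. One induction carries both claims
  because the fourth moment step uses the second moment.\<close>

lemma sign_sum_moments:
  assumes "finite I" "B \<subseteq> I"
  shows "(\<Sum>y\<in>cube I. sign_sum B y ^ 2) = real (card (cube I)) * card B
    \<and> (\<Sum>y\<in>cube I. sign_sum B y ^ 4) \<le> real (card (cube I)) * (3 * real (card B) ^ 2)"
proof -
  have "finite B" using assms finite_subset by blast
  then show ?thesis using assms(2)
  proof (induction B rule: finite_induct)
    case empty
    then show ?case by (simp add: sign_sum_def)
  next
    case (insert b B)
    let ?S = "sign_sum B" and ?e = "\<lambda>y. 2 * y b - 1 :: real"
    let ?M = "real (card (cube I))"
    have b: "b \<in> I" using insert by auto
    have e: "?e y = 1 \<or> ?e y = - 1" if "y \<in> cube I" for y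
      using PiE_mem[OF that b] by auto
    have S: "sign_sum (insert b B) y = ?S y + ?e y" for y
      using insert by (simp add: sign_sum_def)
    have S_flip: "?S (y(b := z)) = ?S y" for y z
      unfolding sign_sum_def using insert by (intro sum.cong) auto
    have odd: "(\<Sum>y\<in>cube I. ?S y ^ k * ?e y) = 0" for k
      by (rule sum_cube_odd_eq_0[OF b]) (simp add: S_flip algebra_simps)
    \<comment> \<open>The exponent \<open>^ 1\<close> is kept so that \<open>odd\<close> applies to
      this term with \<open>k\<close> = 1.\<close>
    have "(\<Sum>y\<in>cube I. sign_sum (insert b B) y ^ 2)
        = (\<Sum>y\<in>cube I. ?S y ^ 2 + 2 * (?S y ^ 1 * ?e y) + 1)"
    proof (rule sum.cong[OF refl])
      fix y assume "y \<in> cube I"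
      from e[OF this] show "sign_sum (insert b B) y ^ 2 = ?S y ^ 2 + 2 * (?S y ^ 1 * ?e y) + 1"
        unfolding S by (elim disjE; simp only:) (simp_all add: algebra_simps power2_eq_square power3_eq_cube power4_eq_xxxx)
    qed
    also have "\<dots> = ?M * card (insert b B)"
      unfolding sum.distrib sum_distrib_left[symmetric] odd
      using insert by (simp add: algebra_simps)
    finally have 2: "(\<Sum>y\<in>cube I. sign_sum (insert b B) y ^ 2) = ?M * card (insert b B)" .
    have "(\<Sum>y\<in>cube I. sign_sum (insert b B) y ^ 4)
        = (\<Sum>y\<in>cube I. ?S y ^ 4 + 4 * (?S y ^ 3 * ?e y) + 6 * ?S y ^ 2 + 4 * (?S y ^ 1 * ?e y) + 1)"
    proof (rule sum.cong[OF refl])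
      fix y assume "y \<in> cube I"
      from e[OF this] show "sign_sum (insert b B) y ^ 4
          = ?S y ^ 4 + 4 * (?S y ^ 3 * ?e y) + 6 * ?S y ^ 2 + 4 * (?S y ^ 1 * ?e y) + 1"
        unfolding S by (elim disjE; simp only:) (simp_all add: algebra_simps power2_eq_square power3_eq_cube power4_eq_xxxx)
    qed
    also have "\<dots> = (\<Sum>y\<in>cube I. ?S y ^ 4) + 6 * (\<Sum>y\<in>cube I. ?S y ^ 2) + ?M"
      unfolding sum.distrib sum_distrib_left[symmetric] odd by simp
    \<comment> \<open>The last summand is enlarged from 1 to 3 per point, which completes the
      square: 3 n^2 + 6 n + 3 = 3 (n + 1)^2.\<close>
    also have "\<dots> \<le> ?M * (3 * real (card B) ^ 2) + 6 * (?M * card B) + ?M * 3"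
      using insert by (intro add_mono) auto
    also have "\<dots> = ?M * (3 * real (card (insert b B)) ^ 2)"
      using insert by (simp add: algebra_simps power2_eq_square)
    finally show ?case using 2 by blast
  qed
qed

text \<open>With u = |s| / c this says 3 u^2 - u^4 <= 2 u, that is, u (u - 1)^2 (u + 2) >= 0. The
  minorant is a polynomial in s^2, so its average depends only on the second and fourth
  moments.\<close>

lemma abs_ge_moments:
  fixes s c :: real
  assumes "c > 0"
  shows "(3 / c * s ^ 2 - s ^ 4 / c ^ 3) / 2 \<le> \<bar>s\<bar>"
proof -
  define u where "u = \<bar>s\<bar> / c"
  have s: "\<bar>s\<bar> = c * u" using assms by (simp add: u_def)
  have u: "u \<ge> 0" using assms by (simp add: u_def)
  have "s ^ 2 = (c * u) ^ 2" "s ^ 4 = (c * u) ^ 4"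
    by (simp_all flip: s)
  then have eq: "(3 / c * s ^ 2 - s ^ 4 / c ^ 3) / 2 = c * ((3 * u ^ 2 - u ^ 4) / 2)"
    using assms by (simp add: field_simps power2_eq_square power3_eq_cube power4_eq_xxxx)
  have "0 \<le> u * (u - 1) ^ 2 * (u + 2) / 2" using u by simp
  also have "\<dots> = u - (3 * u ^ 2 - u ^ 4) / 2" by (simp add: field_simps power2_eq_square power4_eq_xxxx)
  finally show ?thesis unfolding eq s using assms by (intro mult_left_mono) auto
qed

lemma khintchine_cube:
  assumes "finite I" "B \<subseteq> I"
  shows "real (card (cube I)) * sqrt (card B / 3) \<le> (\<Sum>y\<in>cube I. \<bar>sign_sum B y\<bar>)"
proof (cases "card B = 0")
  case True
  then show ?thesis by (auto intro: sum_nonneg)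
next
  case False
  \<comment> \<open>For n = \<open>card B\<close>, the moments bound the average of |S| below by (3
    n / c - 3 n^2 / c^3) / 2, which is largest at c^2 = 3 n, with value sqrt (n / 3). The empty case
    is split off to keep c positive.\<close>
  define c where "c = sqrt (3 * real (card B))"
  let ?M = "real (card (cube I))"
  have c: "c > 0" using False by (simp add: c_def)
  have n: "real (card B) = c ^ 2 / 3" by (simp add: c_def)
  have "sqrt (card B / 3) = c / 3"
    using c by (simp add: n real_sqrt_divide power_divide)
  then have "?M * sqrt (card B / 3) = (3 / c * (?M * card B) - ?M * (3 * real (card B) ^ 2) / c ^ 3) / 2"
    using c unfolding n by (simp add: field_simps power2_eq_square power3_eq_cube)
  also have "\<dots> \<le> (3 / c * (\<Sum>y\<in>cube I. sign_sum B y ^ 2) - (\<Sum>y\<in>cube I. sign_sum B y ^ 4) / c ^ 3) / 2"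
    using sign_sum_moments[OF assms] c by (intro divide_right_mono diff_mono) auto
  also have "\<dots> = (\<Sum>y\<in>cube I. (3 / c * sign_sum B y ^ 2 - sign_sum B y ^ 4 / c ^ 3) / 2)"
    by (simp only: sum_divide_distrib sum_distrib_left sum_subtractf[symmetric])
  also have "\<dots> \<le> (\<Sum>y\<in>cube I. \<bar>sign_sum B y\<bar>)"
    by (intro sum_mono abs_ge_moments c)
  finally show ?thesis .
qed

section \<open>The learner on a fixed sequence\<close>

lemma expectation_bind_pmf_finite:
  fixes h :: "'b \<Rightarrow> real"
  assumes "finite (set_pmf p)" "\<And>x. x \<in> set_pmf p \<Longrightarrow> finite (set_pmf (f x))"
  shows "measure_pmf.expectation (bind_pmf p f) h
    = measure_pmf.expectation p (\<lambda>x. measure_pmf.expectation (f x) h)"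
  by (subst pmf_expectation_bind[OF assms order_refl], assumption,
      subst integral_measure_pmf[OF assms(1)]) auto

lemma finite_grid: "finite (grid N)"
proof -
  have "grid N = (\<lambda>k. real k / real N) ` {..N}"
    by (auto simp: grid_def)
  then show ?thesis by simp
qed

text \<open>Causality: later outcomes cannot influence earlier predictions, so flipping
  \<open>y (Suc t)\<close> leaves the law of the first \<open>t\<close> rounds unchanged.\<close>

lemma transcript_pmf_cong:
  assumes "\<And>s. 1 \<le> s \<Longrightarrow> s \<le> t \<Longrightarrow> y s = y' s"
  shows "transcript_pmf L x y t = transcript_pmf L x y' t"
  using assms by (induction t) auto

lemma transcript_sum:
  assumes "h \<in> set_pmf (transcript_pmf L x y t)"
  shows "(\<Sum>(a, p, b) \<leftarrow> h. f a b) = (\<Sum>s=1..t. f (x s) (y s))"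
  using assms by (induction t arbitrary: h) auto

text \<open>The two claims go together: the learner is known to stay on the grid only after
  admissible histories, and finiteness of the support then follows from that of the grid.
  Integrability below rests on this.\<close>

lemma transcript_supported:
  assumes L: "predicts_on_grid X N L"
    and xy: "\<And>s. 1 \<le> s \<Longrightarrow> s \<le> t \<Longrightarrow> x s \<in> X \<and> y s \<in> {0, 1}"
  shows "finite (set_pmf (transcript_pmf L x y t)) \<and>
    (\<forall>h\<in>set_pmf (transcript_pmf L x y t). set h \<subseteq> X \<times> grid N \<times> {0, 1})"
  using xy
proof (induction t)
  case 0
  then show ?case by simp
next
  case (Suc t)
  have IH: "finite (set_pmf (transcript_pmf L x y t))"
    "\<And>h. h \<in> set_pmf (transcript_pmf L x y t) \<Longrightarrow> set h \<subseteq> X \<times> grid N \<times> {0, 1}"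
    using Suc by auto
  have xy: "x (Suc t) \<in> X" "y (Suc t) \<in> {0, 1}" using Suc.prems[of "Suc t"] by auto
  have sub: "set_pmf (L h (x (Suc t))) \<subseteq> grid N" if "h \<in> set_pmf (transcript_pmf L x y t)" for h
    using L IH(2)[OF that] xy(1) unfolding predicts_on_grid_def by blast
  then have "finite (set_pmf (L h (x (Suc t))))" if "h \<in> set_pmf (transcript_pmf L x y t)" for h
    using that finite_grid finite_subset by blast
  then show ?case using IH xy sub by (fastforce simp: set_bind_pmf)
qed

definition pred_sign :: "real \<Rightarrow> real" where
  "pred_sign p = (if p \<le> 1/2 then 1 else - 1)"

lemma vee_loss_eq: "vee_loss p y = pred_sign p * (y - 1/2)"
  by (simp add: vee_loss_def pred_sign_def)

definition expected_loss :: "'x learner \<Rightarrow> (nat \<Rightarrow> 'x) \<Rightarrow> (nat \<Rightarrow> real) \<Rightarrow> nat \<Rightarrow> real" where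
  "expected_loss L x y t = measure_pmf.expectation (transcript_pmf L x y t)
     (\<lambda>h. \<Sum>(a, p, b) \<leftarrow> h. vee_loss p b)"

text \<open>Conditioning on the first \<open>t\<close> rounds isolates the newest outcome: it enters
  the increment only through \<open>y (Suc t) - 1/2\<close>, since the expected sign is fixed before
  it is revealed.\<close>

lemma expected_loss_Suc:
  assumes L: "predicts_on_grid X N L"
    and xy: "\<And>s. 1 \<le> s \<Longrightarrow> s \<le> Suc t \<Longrightarrow> x s \<in> X \<and> y s \<in> {0, 1}"
  shows "expected_loss L x y (Suc t) = expected_loss L x y t +
    (y (Suc t) - 1/2) * measure_pmf.expectation (transcript_pmf L x y t)
       (\<lambda>h. measure_pmf.expectation (L h (x (Suc t))) pred_sign)"
proof -
  let ?P = "transcript_pmf L x y t" and ?x = "x (Suc t)" and ?y = "y (Suc t)"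
  have sup: "finite (set_pmf ?P)" "\<And>h. h \<in> set_pmf ?P \<Longrightarrow> set h \<subseteq> X \<times> grid N \<times> {0, 1}"
    using transcript_supported[OF L, of t x y] xy by auto
  have fin: "finite (set_pmf (L h ?x))" if "h \<in> set_pmf ?P" for h
    using L sup(2)[OF that] xy[of "Suc t"] finite_grid finite_subset
    unfolding predicts_on_grid_def by (metis le_add1 order_refl plus_1_eq_Suc)
  have "expected_loss L x y (Suc t) = measure_pmf.expectation ?P
      (\<lambda>h. measure_pmf.expectation (L h ?x) (\<lambda>p. (\<Sum>(a, p, b) \<leftarrow> h. vee_loss p b) + pred_sign p * (?y - 1/2)))"
    unfolding expected_loss_def transcript_pmf.simps
    by (subst expectation_bind_pmf_finite) (use sup fin in \<open>auto simp: vee_loss_eq\<close>)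
  also have "\<dots> = measure_pmf.expectation ?P
      (\<lambda>h. (\<Sum>(a, p, b) \<leftarrow> h. vee_loss p b) + measure_pmf.expectation (L h ?x) pred_sign * (?y - 1/2))"
  proof (rule integral_cong_AE)
    show "AE h in measure_pmf ?P. measure_pmf.expectation (L h ?x)
        (\<lambda>p. (\<Sum>(a, p, b) \<leftarrow> h. vee_loss p b) + pred_sign p * (?y - 1/2))
      = (\<Sum>(a, p, b) \<leftarrow> h. vee_loss p b) + measure_pmf.expectation (L h ?x) pred_sign * (?y - 1/2)"
    proof (rule AE_pmfI)
      fix h assume h: "h \<in> set_pmf ?P"
      show "measure_pmf.expectation (L h ?x)
        (\<lambda>p. (\<Sum>(a, p, b) \<leftarrow> h. vee_loss p b) + pred_sign p * (?y - 1/2))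
        = (\<Sum>(a, p, b) \<leftarrow> h. vee_loss p b) + measure_pmf.expectation (L h ?x) pred_sign * (?y - 1/2)"
        by (subst Bochner_Integration.integral_add)
          (auto intro!: integrable_measure_pmf_finite fin[OF h])
    qed
  qed auto
  also have "\<dots> = expected_loss L x y t + measure_pmf.expectation ?P
      (\<lambda>h. measure_pmf.expectation (L h ?x) pred_sign) * (?y - 1/2)"
    unfolding expected_loss_def
    by (subst Bochner_Integration.integral_add)
      (auto intro!: integrable_measure_pmf_finite sup)
  finally show ?thesis by (simp add: mult.commute)
qed

text \<open>A martingale argument: each round's increment is odd under flipping its own outcome. The
  bound \<open>t \<le> T\<close> keeps that outcome among the coordinates of the cube.\<close>

lemma sum_expected_loss_eq_0:
  assumes L: "predicts_on_grid X N L" and x: "\<And>s. x s \<in> X" and "t \<le> T"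
  shows "(\<Sum>y\<in>cube {1..T}. expected_loss L x y t) = 0"
  using \<open>t \<le> T\<close>
proof (induction t)
  case 0
  then show ?case by (simp add: expected_loss_def)
next
  case (Suc t)
  let ?q = "\<lambda>y. measure_pmf.expectation (transcript_pmf L x y t)
       (\<lambda>h. measure_pmf.expectation (L h (x (Suc t))) pred_sign)"
  have "(\<Sum>y\<in>cube {1..T}. expected_loss L x y (Suc t))
      = (\<Sum>y\<in>cube {1..T}. expected_loss L x y t + (y (Suc t) - 1/2) * ?q y)"
  proof (intro sum.cong refl expected_loss_Suc[OF L])
    fix y s assume "y \<in> cube {1..T}" "1 \<le> s" "s \<le> Suc t"
    then show "x s \<in> X \<and> y s \<in> {0, 1}" using x Suc.prems by (auto dest: PiE_mem[where x = s])
  qed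
  also have "\<dots> = (\<Sum>y\<in>cube {1..T}. (y (Suc t) - 1/2) * ?q y)"
    using Suc by (simp add: sum.distrib)
  also have "\<dots> = 0"
  proof (rule sum_cube_odd_eq_0[where i = "Suc t"])
    fix y :: "nat \<Rightarrow> real"
    have "transcript_pmf L x (y(Suc t := 1 - y (Suc t))) t = transcript_pmf L x y t"
      by (rule transcript_pmf_cong) auto
    then show "((y(Suc t := 1 - y (Suc t))) (Suc t) - 1/2) * ?q (y(Suc t := 1 - y (Suc t)))
        = - ((y (Suc t) - 1/2) * ?q y)"
      by (simp add: algebra_simps)
  qed (use Suc in auto)
  finally show ?case .
qed

text \<open>A swap map with constant value \<open>h\<close> turns swap regret into ordinary external
  regret. Finiteness of \<open>H\<close> and of the grid bounds the supremum.\<close>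

lemma swap_regret_ge_const:
  assumes "finite H" "h \<in> H" "set tr \<subseteq> X \<times> grid N \<times> Y"
  shows "(\<Sum>(x, p, y) \<leftarrow> tr. loss p y) - (\<Sum>(x, p, y) \<leftarrow> tr. loss (h x) y) \<le> swap_regret loss H N tr"
proof -
  let ?g = "\<lambda>\<phi>. \<Sum>(x, p, y) \<leftarrow> tr. loss p y - loss (\<phi> p x) y"
  \<comment> \<open>Restricted to the grid for extensionality; all predictions in \<open>tr\<close>
    lie there, so the default value is never read.\<close>
  let ?\<phi> = "\<lambda>p\<in>grid N. h"
  have "(\<Sum>(x, p, y) \<leftarrow> tr. loss p y) - (\<Sum>(x, p, y) \<leftarrow> tr. loss (h x) y) = ?g ?\<phi>"
    using assms(3) by (induction tr) auto
  also have "\<dots> \<le> swap_regret loss H N tr"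
    unfolding swap_regret_def using assms
    by (intro cSUP_upper bdd_above_finite finite_imageI finite_PiE finite_grid) auto
  finally show ?thesis .
qed

text \<open>The comparator ignores predictions, so by \<open>transcript_sum\<close> its loss is the
  same on every possible transcript and may be moved inside the expectation.\<close>

lemma expected_swap_regret_ge:
  assumes L: "predicts_on_grid X N L" and H: "finite H" "h \<in> H"
    and xy: "\<And>s. 1 \<le> s \<Longrightarrow> s \<le> T \<Longrightarrow> x s \<in> X \<and> y s \<in> {0, 1}"
  shows "expected_loss L x y T - (\<Sum>s=1..T. vee_loss (h (x s)) (y s))
    \<le> measure_pmf.expectation (transcript_pmf L x y T) (swap_regret vee_loss H N)"
proof -
  let ?P = "transcript_pmf L x y T"
  have sup: "finite (set_pmf ?P)" "\<And>h. h \<in> set_pmf ?P \<Longrightarrow> set h \<subseteq> X \<times> grid N \<times> {0, 1}"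
    using transcript_supported[OF L, of T x y] xy by auto
  have "expected_loss L x y T - (\<Sum>s=1..T. vee_loss (h (x s)) (y s))
     = measure_pmf.expectation ?P
        (\<lambda>tr. (\<Sum>(x, p, y) \<leftarrow> tr. vee_loss p y) - (\<Sum>s=1..T. vee_loss (h (x s)) (y s)))"
    unfolding expected_loss_def
    by (subst Bochner_Integration.integral_diff)
      (auto intro!: integrable_measure_pmf_finite sup)
  also have "\<dots> \<le> measure_pmf.expectation ?P (swap_regret vee_loss H N)"
  proof (rule integral_mono_AE)
    show "AE tr in measure_pmf ?P. (\<Sum>(x, p, y) \<leftarrow> tr. vee_loss p y) -
        (\<Sum>s=1..T. vee_loss (h (x s)) (y s)) \<le> swap_regret vee_loss H N tr"
    proof (rule AE_pmfI)
      fix tr assume tr: "tr \<in> set_pmf ?P"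
      show "(\<Sum>(x, p, y) \<leftarrow> tr. vee_loss p y) -
        (\<Sum>s=1..T. vee_loss (h (x s)) (y s)) \<le> swap_regret vee_loss H N tr"
        using swap_regret_ge_const[OF H sup(2)[OF tr], of vee_loss]
          transcript_sum[OF tr, of "\<lambda>a b. vee_loss (h a) b"] by simp
    qed
  qed (auto intro!: integrable_measure_pmf_finite sup)
  finally show ?thesis .
qed

section \<open>The cyclic context sequence\<close>

definition residue_rounds :: "nat \<Rightarrow> nat \<Rightarrow> nat \<Rightarrow> nat set" where
  "residue_rounds d T j = {t \<in> {1..T}. t mod d = j}"

text \<open>Each of the \<open>T div d\<close> complete blocks of \<open>d\<close> consecutive
  rounds meets the residue class once.\<close>

lemma card_residue_rounds:
  assumes "j < d"
  shows "T div d \<le> card (residue_rounds d T j)"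
proof -
  \<comment> \<open>Rounds start at 1, so residue 0 is represented by \<open>d\<close>.\<close>
  define r where "r = (if j = 0 then d else j)"
  have r: "1 \<le> r" "r \<le> d" "r mod d = j" using assms by (auto simp: r_def)
  have "(\<lambda>k. k * d + r) ` {..<T div d} \<subseteq> residue_rounds d T j"
  proof safe
    fix k assume "k < T div d"
    then have "Suc k * d \<le> T div d * d" by (intro mult_right_mono) auto
    also have "\<dots> \<le> T" by simp
    finally show "k * d + r \<in> residue_rounds d T j"
      using r by (simp add: residue_rounds_def)
  qed
  moreover have "inj_on (\<lambda>k. k * d + r) {..<T div d}"
    using assms by (auto simp: inj_on_def)
  moreover have "finite (residue_rounds d T j)" by (simp add: residue_rounds_def)
  ultimately show ?thesis
    by (metis card_image card_lessThan card_mono)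
qed

lemma best_comparator:
  assumes "d \<ge> 1"
  obtains h where "h \<in> cube {..<d}"
    "(\<Sum>s=1..T. vee_loss (h (s mod d)) (y s)) = - (\<Sum>j<d. \<bar>sign_sum (residue_rounds d T j) y\<bar> / 2)"
proof -
  define S where "S j = sign_sum (residue_rounds d T j) y" for j
  \<comment> \<open>Majority vote on each context: the value 1 exceeds 1/2 and so gives the sign -1,
    which is right when outcome 1 prevails.\<close>
  define h where "h = (\<lambda>j\<in>{..<d}. if S j \<ge> 0 then 1 else 0 :: real)"
  have "(\<Sum>s=1..T. vee_loss (h (s mod d)) (y s))
      = (\<Sum>j<d. \<Sum>s\<in>residue_rounds d T j. vee_loss (h (s mod d)) (y s))"
    unfolding residue_rounds_def using assms
    by (intro sum.group[symmetric]) auto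
  also have "\<dots> = (\<Sum>j<d. - (\<bar>S j\<bar> / 2))"
  proof (rule sum.cong[OF refl])
    fix j assume j: "j \<in> {..<d}"
    have "(\<Sum>s\<in>residue_rounds d T j. vee_loss (h (s mod d)) (y s))
       = (\<Sum>s\<in>residue_rounds d T j. pred_sign (h j) / 2 * (2 * y s - 1))"
      by (rule sum.cong) (auto simp: residue_rounds_def vee_loss_eq algebra_simps)
    also have "\<dots> = pred_sign (h j) / 2 * S j"
      by (simp add: S_def sign_sum_def sum_distrib_left)
    also have "\<dots> = - (\<bar>S j\<bar> / 2)" using j by (simp add: h_def pred_sign_def)
    finally show "(\<Sum>s\<in>residue_rounds d T j. vee_loss (h (s mod d)) (y s)) = - (\<bar>S j\<bar> / 2)" .
  qed
  finally have "(\<Sum>s=1..T. vee_loss (h (s mod d)) (y s)) = - (\<Sum>j<d. \<bar>S j\<bar> / 2)"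
    by (simp add: sum_negf)
  moreover have "h \<in> cube {..<d}" by (auto simp: h_def)
  ultimately show ?thesis using that unfolding S_def by blast
qed

lemma swap_regret_lower_bound:
  assumes d: "1 \<le> d" "real d \<le> real T / 2" and L: "predicts_on_grid {..<d} N L"
  obtains y where "y \<in> cube {1..T}"
    "1/48 * sqrt (real d * real T) \<le>
      measure_pmf.expectation (transcript_pmf L (\<lambda>t. t mod d) y T) (swap_regret vee_loss (cube {..<d}) N)"
proof -
  let ?I = "{1..T}" and ?x = "\<lambda>t. t mod d"
  let ?R = "\<lambda>y. measure_pmf.expectation (transcript_pmf L ?x y T) (swap_regret vee_loss (cube {..<d}) N)"
  let ?B = "residue_rounds d T" and ?M = "real (card (cube ?I))"
  \<comment> \<open>With m = \<open>T div d\<close> >= 1 complete cycles, T < (m + 1) d <= 2 m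
    d.\<close>
  have "T < Suc (T div d) * d" using d(1) by (simp add: dividend_less_div_times)
  also have "1 \<le> T div d" using d by (simp add: div_greater_zero_iff Suc_le_eq)
  then have "Suc (T div d) * d \<le> 2 * (T div d) * d" by (intro mult_right_mono) auto
  finally have "real T \<le> real (2 * (T div d) * d)" by linarith
  then have m: "real T \<le> 2 * real (T div d) * real d" by simp
  \<comment> \<open>Here 576 = 24^2 and 48 = 2 * 24. The estimate \<open>m\<close> gives T / (6 d)
    <= (T div d) / 3, so T / (576 d) lies below it with room to spare.\<close>
  have "1/48 * sqrt (real d * real T) = real d * (sqrt (real T / (576 * real d)) / 2)"
  proof -
    have "real d * real T = (24 * real d) ^ 2 * (real T / (576 * real d))"
      using d by (simp add: field_simps power2_eq_square)
    then have "sqrt (real d * real T) = 24 * real d * sqrt (real T / (576 * real d))"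
      using d by (simp only: real_sqrt_mult real_sqrt_abs)
    then show ?thesis by simp
  qed
  also have "\<dots> \<le> real d * (sqrt (real (T div d) / 3) / 2)"
    using m d by (intro mult_left_mono divide_right_mono real_sqrt_le_mono) (auto simp: field_simps)
  finally have "?M * (1/48 * sqrt (real d * real T)) \<le> ?M * (real d * (sqrt (real (T div d) / 3) / 2))"
    by (intro mult_left_mono) auto
  also have "\<dots> = (\<Sum>j<d. ?M * sqrt (real (T div d) / 3) / 2)" by simp
  also have "\<dots> \<le> (\<Sum>j<d. (\<Sum>y\<in>cube ?I. \<bar>sign_sum (?B j) y\<bar>) / 2)"
  proof (intro sum_mono divide_right_mono)
    fix j assume "j \<in> {..<d}"
    then have "?M * sqrt (real (T div d) / 3) \<le> ?M * sqrt (card (?B j) / 3)"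
      using card_residue_rounds[of j d T]
      by (intro mult_left_mono real_sqrt_le_mono) auto
    also have "\<dots> \<le> (\<Sum>y\<in>cube ?I. \<bar>sign_sum (?B j) y\<bar>)"
      by (rule khintchine_cube) (auto simp: residue_rounds_def)
    finally show "?M * sqrt (real (T div d) / 3) \<le> (\<Sum>y\<in>cube ?I. \<bar>sign_sum (?B j) y\<bar>)" .
  qed simp
  \<comment> \<open>The expected losses sum to 0 over the cube, so they can be inserted to form the
    regret for each \<open>y\<close>.\<close>
  also have "\<dots> = (\<Sum>y\<in>cube ?I. expected_loss L ?x y T + (\<Sum>j<d. \<bar>sign_sum (?B j) y\<bar> / 2))"
    using sum_expected_loss_eq_0[OF L, of ?x T T] d(1)
    by (simp add: sum.distrib sum_divide_distrib sum.swap[of _ "{..<d}"])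
  also have "\<dots> \<le> (\<Sum>y\<in>cube ?I. ?R y)"
  proof (rule sum_mono)
    fix y assume y: "y \<in> cube ?I"
    obtain h where h: "h \<in> cube {..<d}"
      "(\<Sum>s=1..T. vee_loss (h (?x s)) (y s)) = - (\<Sum>j<d. \<bar>sign_sum (?B j) y\<bar> / 2)"
      using best_comparator[OF d(1)] by blast
    have "?x s \<in> {..<d} \<and> y s \<in> {0, 1}" if "1 \<le> s" "s \<le> T" for s
      using that d(1) PiE_mem[OF y, of s] by simp
    from expected_swap_regret_ge[OF L finite_cube h(1), where x = ?x and T = T and y = y, OF _ this]
    show "expected_loss L ?x y T + (\<Sum>j<d. \<bar>sign_sum (?B j) y\<bar> / 2) \<le> ?R y"
      using h(2) by simp
  qed
  finally have avg: "(\<Sum>y\<in>cube ?I. 1/48 * sqrt (real d * real T)) \<le> (\<Sum>y\<in>cube ?I. ?R y)"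
    by simp
  have "card (cube ?I) \<noteq> 0" by (simp add: card_cube)
  then have "cube ?I \<noteq> {}" by (metis card.empty)
  \<comment> \<open>Were the regret below the bound at every point of this finite nonempty cube, the
    two sums in \<open>avg\<close> would compare strictly the other way.\<close>
  then have "\<exists>y\<in>cube ?I. 1/48 * sqrt (real d * real T) \<le> ?R y"
    using sum_strict_mono[of "cube ?I" ?R "\<lambda>_. 1/48 * sqrt (real d * real T)"] avg finite_cube[of ?I]
    by (meson finite_atLeastAtMost linorder_not_le)
  then show ?thesis using that by blast
qed

theorem lemma5p11:
  "\<exists>c::real. c > 0 \<and> (\<forall>(d::nat) (T::nat). 1 \<le> d \<and> real d \<le> real T / 2 \<longrightarrow>
     (\<exists>(X::nat set) (H::(nat \<Rightarrow> real) set).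
        H \<subseteq> X \<rightarrow>\<^sub>E {0..1} \<and> card H = 2 ^ d \<and>
        (\<forall>(N::nat) (L::nat learner). N \<ge> 1 \<and> predicts_on_grid X N L \<longrightarrow>
           (\<exists>(x::nat \<Rightarrow> nat) (y::nat \<Rightarrow> real).
              (\<forall>t\<in>{1..T}. x t \<in> X \<and> y t \<in> {0, 1}) \<and>
              measure_pmf.expectation (transcript_pmf L x y T) (swap_regret vee_loss H N)
                \<ge> 1/48 * sqrt (real d * real T))) \<and>
        1/48 * sqrt (real d * real T) \<ge> c * sqrt (real T * ln (real (card H)))))"
proof (intro exI[of _ "1/48"] conjI allI impI)
  fix d T :: nat
  assume dT: "1 \<le> d \<and> real d \<le> real T / 2"
  let ?X = "{..<d}"
  have sub: "cube ?X \<subseteq> ?X \<rightarrow>\<^sub>E {0..1}" by (intro PiE_mono) auto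
  have card: "card (cube ?X) = 2 ^ d" by (simp add: card_cube)
  have regret: "\<exists>x y. (\<forall>t\<in>{1..T}. x t \<in> ?X \<and> y t \<in> {0, 1}) \<and>
      measure_pmf.expectation (transcript_pmf L x y T) (swap_regret vee_loss (cube ?X) N)
        \<ge> 1/48 * sqrt (real d * real T)" if L: "predicts_on_grid ?X N L" for N L
  proof -
    obtain y where y: "y \<in> cube {1..T}" "1/48 * sqrt (real d * real T) \<le>
      measure_pmf.expectation (transcript_pmf L (\<lambda>t. t mod d) y T) (swap_regret vee_loss (cube ?X) N)"
      using swap_regret_lower_bound[OF _ _ L, of T] dT by blast
    have xy: "\<forall>t\<in>{1..T}. t mod d \<in> ?X \<and> y t \<in> {0, 1}"
      using y(1) dT by (auto dest: PiE_mem)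
    show ?thesis by (intro exI[of _ "\<lambda>t. t mod d"] exI[of _ y] conjI xy y(2))
  qed
  \<comment> \<open>Since ln |H| = d ln 2 <= d, the constant 1/48 also serves for the rate in terms
    of |H|.\<close>
  have "real T * (real d * ln 2) \<le> real T * (real d * 1)"
    using ln_2_less_1 by (intro mult_left_mono) auto
  then have rate: "1/48 * sqrt (real d * real T) \<ge> 1/48 * sqrt (real T * ln (real (card (cube ?X))))"
    by (simp add: card ln_realpow mult.commute)
  show "\<exists>(X::nat set) (H::(nat \<Rightarrow> real) set).
        H \<subseteq> X \<rightarrow>\<^sub>E {0..1} \<and> card H = 2 ^ d \<and>
        (\<forall>(N::nat) (L::nat learner). N \<ge> 1 \<and> predicts_on_grid X N L \<longrightarrow>
           (\<exists>(x::nat \<Rightarrow> nat) (y::nat \<Rightarrow> real).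
              (\<forall>t\<in>{1..T}. x t \<in> X \<and> y t \<in> {0, 1}) \<and>
              measure_pmf.expectation (transcript_pmf L x y T) (swap_regret vee_loss H N)
                \<ge> 1/48 * sqrt (real d * real T))) \<and>
        1/48 * sqrt (real d * real T) \<ge> 1/48 * sqrt (real T * ln (real (card H)))"
    by (intro exI[of _ ?X] exI[of _ "cube ?X"] conjI allI impI sub card rate regret) (elim conjE)
qed simp

end
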